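(* If $\mathcal{F} = \{\psi_i : i \in I\} \subset L^2(\mathbb{R})$ is an interpolation family of wavelets, then all of the wavelets in $\mathcal{F}$ are core equivalent to one another.
   Context: A function $\psi \in L^2(\mathbb{R})$ is a wavelet if $\{2^{j/2}\psi(2^j x + n) : j,n \in \mathbb{Z}\}$ is an orthonormal basis of $L^2(\mathbb{R})$. Define unitary operators on $L^2(\mathbb{R})$ by $Df(x) = \sqrt{2}\, f(2x)$ and $Tf(x) = f(x+1)$. The local commutant at $\psi$ is $$\mathcal{C}_\psi(D,T) = \{V \in \mathcal{B}(L^2(\mathbb{R})) : V D^n T^l \psi = D^n T^l V \psi \text{ for all } n,l \in \mathbb{Z}\}.$$ For wavelets $\psi,\eta$, the unitary corresponding to the pair $(\psi,\eta)$ is the unique unitary $U \in \mathcal{C}_\psi(D,T)$ with $U\psi = \eta$, i.e. the unitary determined by $U D^n T^l\psi = D^n T^l \eta$ for all $n,l\in\mathbb{Z}$. A collection of wavelets $\{\psi_i : i \in I\}$ is an interpolation family if, for each pair $\psi_i,\psi_j$ in the collection, with corresponding unitary $U \in \mathcal{C}_{\psi_i}(D,T)$ satisfying $U\psi_i = \psi_j$, all powers $U^n$ ($n \in \mathbb{Z}$) lie in $\mathcal{C}_{\psi_i}(D,T)$ and all the wavelets $U^n\psi_i$ again belong to the collection. The core space of a wavelet $\psi$ is $V_0^\psi = \overline{\mathrm{span}}\{D^n T^l \psi : n < 0,\ l \in \mathbb{Z}\}$. It is invariant under $T$ and $T^{-1}$, and the unitary representation $l \mapsto T^l|_{V_0^\psi}$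 of $\mathbb{Z}$ is called the core representation of $\psi$. Two wavelets are core equivalent if their core representations are unitarily equivalent. *)

theory Defs
  imports "HOL-Analysis.Analysis"
begin

section \<open>The complex Hilbert space of square-integrable functions on the line\<close>

text \<open>Borel representatives suffice: every Lebesgue-measurable function agrees almost
  everywhere with a Borel-measurable one.\<close>

definition square_integrable :: "(real \<Rightarrow> complex) \<Rightarrow> bool" where
  "square_integrable f \<longleftrightarrow>
     f \<in> borel_measurable borel \<and> integrable lborel (\<lambda>x. (cmod (f x))\<^sup>2)"

definition l2_eq :: "(real \<Rightarrow> complex) \<Rightarrow> (real \<Rightarrow> complex) \<Rightarrow> bool" where
  "l2_eq f g \<longleftrightarrow>
     square_integrable f \<and> square_integrable g \<and> (AE x in lborel. f x = g x)"

lemma square_integrable_measurable [measurable_dest]: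
  "square_integrable f \<Longrightarrow> f \<in> borel_measurable borel"
  by (simp add: square_integrable_def)

lemma cnj_measurable [measurable]: "cnj \<in> borel_measurable borel"
  by (intro borel_measurable_continuous_onI continuous_intros)

lemma square_integrable_zero: "square_integrable (\<lambda>x. 0)"
  by (simp add: square_integrable_def)

lemma square_integrable_add:
  assumes "square_integrable f" "square_integrable g"
  shows "square_integrable (\<lambda>x. f x + g x)"
proof -
  note [measurable] = assms[THEN square_integrable_measurable]
  have "integrable lborel (\<lambda>x. 2 * (cmod (f x))\<^sup>2 + 2 * (cmod (g x))\<^sup>2)"
    using assms by (auto simp: square_integrable_def)
  then have "integrable lborel (\<lambda>x. (cmod (f x + g x))\<^sup>2)"
  proof (rule Bochner_Integration.integrable_bound)
    show "AE x in lborel. norm ((cmod (f x + g x))\<^sup>2)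
            \<le> norm (2 * (cmod (f x))\<^sup>2 + 2 * (cmod (g x))\<^sup>2)"
    proof (rule AE_I2)
      fix x
      have "(cmod (f x + g x))\<^sup>2 \<le> (cmod (f x) + cmod (g x))\<^sup>2"
        by (intro power_mono norm_triangle_ineq) simp
      also have "\<dots> \<le> 2 * (cmod (f x))\<^sup>2 + 2 * (cmod (g x))\<^sup>2"
        using zero_le_power2[of "cmod (f x) - cmod (g x)"]
        by (simp add: power2_eq_square algebra_simps)
      finally show "norm ((cmod (f x + g x))\<^sup>2)
            \<le> norm (2 * (cmod (f x))\<^sup>2 + 2 * (cmod (g x))\<^sup>2)" by simp
    qed
  qed measurable
  then show ?thesis by (simp add: square_integrable_def)
qed

lemma square_integrable_scale:
  assumes "square_integrable f"
  shows "square_integrable (\<lambda>x. c * f x)"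
  using assms by (auto simp: square_integrable_def norm_mult power_mult_distrib)

lemma square_integrable_scale_right:
  "square_integrable f \<Longrightarrow> square_integrable (\<lambda>x. f x * c)"
  using square_integrable_scale[of f c] by (simp add: mult.commute)

lemma square_integrable_mult_cnj:
  assumes "square_integrable f" "square_integrable g"
  shows "integrable lborel (\<lambda>x. f x * cnj (g x))"
proof -
  note [measurable] = assms[THEN square_integrable_measurable]
  have "integrable lborel (\<lambda>x. (cmod (f x))\<^sup>2 + (cmod (g x))\<^sup>2)"
    using assms by (auto simp: square_integrable_def)
  then show ?thesis
  proof (rule Bochner_Integration.integrable_bound)
    show "AE x in lborel. norm (f x * cnj (g x)) \<le> norm ((cmod (f x))\<^sup>2 + (cmod (g x))\<^sup>2)"
    proof (rule AE_I2)
      fix x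
      have "0 \<le> cmod (f x) * cmod (g x)" by simp
      then have "cmod (f x) * cmod (g x) \<le> (cmod (f x))\<^sup>2 + (cmod (g x))\<^sup>2"
        using sum_squares_bound[of "cmod (f x)" "cmod (g x)"] by linarith
      then show "norm (f x * cnj (g x)) \<le> norm ((cmod (f x))\<^sup>2 + (cmod (g x))\<^sup>2)"
        by (simp add: norm_mult)
    qed
  qed measurable
qed

lemma square_integrable_affine:
  assumes "square_integrable f" "c \<noteq> 0"
  shows "square_integrable (\<lambda>x. k * f (c * x + t))"
proof -
  note [measurable] = assms(1)[THEN square_integrable_measurable]
  have "integrable lborel (\<lambda>x. (cmod (f (t + c * x)))\<^sup>2)"
    using assms lborel_integrable_real_affine[of "\<lambda>x. (cmod (f x))\<^sup>2" c t]
    by (auto simp: square_integrable_def)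
  then have "square_integrable (\<lambda>x. f (c * x + t))"
    by (simp add: square_integrable_def add.commute)
  then show ?thesis by (rule square_integrable_scale)
qed

lemma l2_eq_affine:
  assumes "l2_eq f g" "c \<noteq> 0"
  shows "l2_eq (\<lambda>x. k * f (c * x + t)) (\<lambda>x. k * g (c * x + t))"
proof -
  have sq: "square_integrable f" "square_integrable g" and ae: "AE x in lborel. f x = g x"
    using assms by (auto simp: l2_eq_def)
  note [measurable] = sq[THEN square_integrable_measurable]
  have "AE x in lborel. f (t + c * x) = g (t + c * x)"
    using assms(2) ae by (intro AE_borel_affine) measurable
  then have "AE x in lborel. k * f (c * x + t) = k * g (c * x + t)"
    by (simp add: add.commute)
  with sq assms(2) show ?thesis by (auto simp: l2_eq_def intro: square_integrable_affine)
qed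

quotient_type l2 = "real \<Rightarrow> complex" / partial: l2_eq
proof (rule part_equivpI)
  show "\<exists>f. l2_eq f f"
    using square_integrable_zero by (auto simp: l2_eq_def)
  show "symp l2_eq"
    by (rule sympI) (auto simp: l2_eq_def)
  show "transp l2_eq"
    by (rule transpI) (auto simp: l2_eq_def)
qed

lift_definition scaleC_l2 :: "complex \<Rightarrow> l2 \<Rightarrow> l2"  (infixr \<open>*\<^sub>C\<close> 75)
  is "\<lambda>c f x. c * f x"
  by (auto simp: l2_eq_def intro: square_integrable_scale)

lift_definition cinner_l2 :: "l2 \<Rightarrow> l2 \<Rightarrow> complex"
  is "\<lambda>f g. \<integral>x. f x * cnj (g x) \<partial>lborel"
proof -
  fix f f' g g' assume "l2_eq f f'" "l2_eq g g'"
  then have sq: "square_integrable f" "square_integrable f'"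
      "square_integrable g" "square_integrable g'"
    and ae: "AE x in lborel. f x = f' x" "AE x in lborel. g x = g' x"
    by (auto simp: l2_eq_def)
  note [measurable] = sq[THEN square_integrable_measurable]
  show "(\<integral>x. f x * cnj (g x) \<partial>lborel) = (\<integral>x. f' x * cnj (g' x) \<partial>lborel)"
  proof (rule integral_cong_AE)
    show "AE x in lborel. f x * cnj (g x) = f' x * cnj (g' x)"
      using ae by eventually_elim simp
  qed measurable
qed

instantiation l2 :: real_vector
begin

lift_definition zero_l2 :: l2 is "\<lambda>x. 0"
  by (simp add: l2_eq_def square_integrable_zero)

lift_definition plus_l2 :: "l2 \<Rightarrow> l2 \<Rightarrow> l2" is "\<lambda>f g x. f x + g x"
  by (auto simp: l2_eq_def intro: square_integrable_add)

definition uminus_l2 :: "l2 \<Rightarrow> l2" where "uminus_l2 f = (-1) *\<^sub>C f"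
definition minus_l2 :: "l2 \<Rightarrow> l2 \<Rightarrow> l2" where "minus_l2 f g = f + (-1) *\<^sub>C g"
definition scaleR_l2 :: "real \<Rightarrow> l2 \<Rightarrow> l2" where "scaleR_l2 r f = complex_of_real r *\<^sub>C f"

instance
proof
  fix f g h :: l2 and r s :: real
  show "f + g + h = f + (g + h)"
    by transfer (auto simp: l2_eq_def algebra_simps intro!: square_integrable_add)
  show "f + g = g + f"
    by transfer (auto simp: l2_eq_def algebra_simps intro!: square_integrable_add)
  show "0 + f = f"
    by transfer (auto simp: l2_eq_def)
  show "- f + f = 0"
    unfolding uminus_l2_def
    by transfer (auto simp: l2_eq_def square_integrable_zero)
  show "f - g = f + - g"
    by (simp add: uminus_l2_def minus_l2_def)
  show "r *\<^sub>R (f + g) = r *\<^sub>R f + r *\<^sub>R g"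
    unfolding scaleR_l2_def
    by transfer (auto simp: l2_eq_def algebra_simps
        intro!: square_integrable_add square_integrable_scale square_integrable_scale_right)
  show "(r + s) *\<^sub>R f = r *\<^sub>R f + s *\<^sub>R f"
    unfolding scaleR_l2_def
    by transfer (auto simp: l2_eq_def algebra_simps
        intro!: square_integrable_add square_integrable_scale square_integrable_scale_right)
  show "r *\<^sub>R s *\<^sub>R f = (r * s) *\<^sub>R f"
    unfolding scaleR_l2_def
    by transfer (auto simp: l2_eq_def algebra_simps intro!: square_integrable_scale square_integrable_scale_right)
  show "1 *\<^sub>R f = f"
    unfolding scaleR_l2_def by transfer (auto simp: l2_eq_def)
qed

end

interpretation l2: vector_space scaleC_l2
proof
  fix a b :: complex and f g :: l2
  show "a *\<^sub>C (f + g) = a *\<^sub>C f + a *\<^sub>C g"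
    by transfer (auto simp: l2_eq_def algebra_simps
        intro!: square_integrable_add square_integrable_scale square_integrable_scale_right)
  show "(a + b) *\<^sub>C f = a *\<^sub>C f + b *\<^sub>C f"
    by transfer (auto simp: l2_eq_def algebra_simps
        intro!: square_integrable_add square_integrable_scale square_integrable_scale_right)
  show "a *\<^sub>C b *\<^sub>C f = (a * b) *\<^sub>C f"
    by transfer (auto simp: l2_eq_def algebra_simps intro!: square_integrable_scale square_integrable_scale_right)
  show "1 *\<^sub>C f = f"
    by transfer (auto simp: l2_eq_def)
qed

lemma cinner_l2_commute: "cinner_l2 f g = cnj (cinner_l2 g f)"
proof (transfer, goal_cases)
  case (1 f g)
  have "(\<integral>x. f x * cnj (g x) \<partial>lborel) = (\<integral>x. cnj (g x * cnj (f x)) \<partial>lborel)"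
    by (simp add: mult.commute)
  also have "\<dots> = cnj (\<integral>x. g x * cnj (f x) \<partial>lborel)"
    using 1 by (intro integral_bounded_linear [OF bounded_linear_cnj] square_integrable_mult_cnj)
      (auto simp: l2_eq_def)
  finally show ?case .
qed

lemma cinner_l2_add_left: "cinner_l2 (f + g) h = cinner_l2 f h + cinner_l2 g h"
  by transfer
    (auto simp: l2_eq_def distrib_right
      intro!: Bochner_Integration.integral_add square_integrable_mult_cnj)

lemma cinner_l2_scaleC_left: "cinner_l2 (c *\<^sub>C f) g = c * cinner_l2 f g"
  by transfer (simp add: mult.assoc)

lemma cinner_l2_self_real: "cinner_l2 f f = complex_of_real (Re (cinner_l2 f f))"
  by (metis Reals_cnj_iff cinner_l2_commute of_real_Re)

lemma Re_cinner_l2_self_ge_zero: "0 \<le> Re (cinner_l2 f f)"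
proof (transfer, goal_cases)
  case (1 f)
  have "(\<integral>x. f x * cnj (f x) \<partial>lborel) = complex_of_real (\<integral>x. (cmod (f x))\<^sup>2 \<partial>lborel)"
    by (simp add: complex_norm_square [symmetric] del: of_real_power)
  then show ?case by simp
qed

lemma Re_cinner_l2_self_eq_zero_iff: "Re (cinner_l2 f f) = 0 \<longleftrightarrow> f = 0"
proof (transfer, goal_cases)
  case (1 f)
  then have f: "square_integrable f" by (simp add: l2_eq_def)
  have "(\<integral>x. f x * cnj (f x) \<partial>lborel) = complex_of_real (\<integral>x. (cmod (f x))\<^sup>2 \<partial>lborel)"
    by (simp add: complex_norm_square [symmetric] del: of_real_power)
  moreover have "(\<integral>x. (cmod (f x))\<^sup>2 \<partial>lborel) = 0 \<longleftrightarrow> (AE x in lborel. (cmod (f x))\<^sup>2 = 0)"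
    using f by (intro integral_nonneg_eq_0_iff_AE) (auto simp: square_integrable_def)
  ultimately show ?case
    using f by (simp add: l2_eq_def square_integrable_zero)
qed

instantiation l2 :: real_inner
begin

definition inner_l2 :: "l2 \<Rightarrow> l2 \<Rightarrow> real" where "inner_l2 f g = Re (cinner_l2 f g)"
definition norm_l2 :: "l2 \<Rightarrow> real" where "norm_l2 f = sqrt (inner f f)"
definition sgn_l2 :: "l2 \<Rightarrow> l2" where "sgn_l2 f = f /\<^sub>R norm f"
definition dist_l2 :: "l2 \<Rightarrow> l2 \<Rightarrow> real" where "dist_l2 f g = norm (f - g)"
definition uniformity_l2 :: "(l2 \<times> l2) filter"
  where "uniformity_l2 = (INF e\<in>{0<..}. principal {(f, g). dist f g < e})"
definition open_l2 :: "l2 set \<Rightarrow> bool"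
  where "open_l2 S \<longleftrightarrow> (\<forall>f\<in>S. \<forall>\<^sub>F (f', g) in uniformity. f' = f \<longrightarrow> g \<in> S)"

instance
proof
  fix f g h :: l2 and r :: real and S :: "l2 set"
  show "dist f g = norm (f - g)" by (rule dist_l2_def)
  show "sgn f = f /\<^sub>R norm f" by (rule sgn_l2_def)
  show "(uniformity :: (l2 \<times> l2) filter) = (INF e\<in>{0<..}. principal {(f, g). dist f g < e})"
    by (rule uniformity_l2_def)
  show "open S \<longleftrightarrow> (\<forall>f\<in>S. \<forall>\<^sub>F (f', g) in uniformity. f' = f \<longrightarrow> g \<in> S)"
    by (rule open_l2_def)
  show "inner f g = inner g f"
    by (metis inner_l2_def cinner_l2_commute cnj.simps(1))
  show "inner (f + g) h = inner f h + inner g h"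
    by (simp add: inner_l2_def cinner_l2_add_left)
  show "inner (r *\<^sub>R f) g = r * inner f g"
    by (simp add: inner_l2_def scaleR_l2_def cinner_l2_scaleC_left)
  show "0 \<le> inner f f"
    by (simp add: inner_l2_def Re_cinner_l2_self_ge_zero)
  show "inner f f = 0 \<longleftrightarrow> f = 0"
    by (simp add: inner_l2_def Re_cinner_l2_self_eq_zero_iff)
  show "norm f = sqrt (inner f f)" by (rule norm_l2_def)
qed

end

section \<open>Operators on subspaces\<close>

text \<open>\<open>isometric_iso H K W\<close>: the restriction of \<open>W\<close> to the complex subspace \<open>H\<close> is a unitary
  operator from \<open>H\<close> onto \<open>K\<close>; values of \<open>W\<close> outside \<open>H\<close> are irrelevant.\<close>

definition isometric_iso :: "l2 set \<Rightarrow> l2 set \<Rightarrow> (l2 \<Rightarrow> l2) \<Rightarrow> bool" where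
  "isometric_iso H K W \<longleftrightarrow>
     (\<forall>f\<in>H. \<forall>g\<in>H. W (f + g) = W f + W g) \<and>
     (\<forall>c. \<forall>f\<in>H. W (c *\<^sub>C f) = c *\<^sub>C W f) \<and>
     (\<forall>f\<in>H. \<forall>g\<in>H. cinner_l2 (W f) (W g) = cinner_l2 f g) \<and>
     W ` H = K"

abbreviation unitary_op :: "(l2 \<Rightarrow> l2) \<Rightarrow> bool" where
  "unitary_op \<equiv> isometric_iso UNIV UNIV"

definition bounded_operators :: "(l2 \<Rightarrow> l2) set" where
  "bounded_operators = {V. Vector_Spaces.linear scaleC_l2 scaleC_l2 V \<and> bounded_linear V}"

text \<open>Integer powers of a bijection.\<close>

definition int_power :: "('a \<Rightarrow> 'a) \<Rightarrow> int \<Rightarrow> 'a \<Rightarrow> 'a" where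
  "int_power f n = (if 0 \<le> n then f ^^ nat n else inv f ^^ nat (- n))"

lemma int_power_unique:
  assumes "bij f" and "g 0 = x" and step: "\<And>n. f (g n) = g (n + 1)"
  shows "int_power f n x = g n"
proof -
  have pos: "(f ^^ k) x = g (int k)" for k
    by (induction k) (simp_all add: assms add.commute)
  have "inv f (g n) = g (n - 1)" for n
    using step[of "n - 1"] \<open>bij f\<close> by (simp add: bij_is_inj inv_f_eq)
  then have neg: "(inv f ^^ k) x = g (- int k)" for k
  proof (induction k)
    case (Suc k)
    moreover have "- int k - 1 = - int (Suc k)" by simp
    ultimately show ?case using \<open>\<And>n. inv f (g n) = g (n - 1)\<close> by (metis comp_apply funpow.simps(2))
  qed (simp add: assms)
  show ?thesis
    using pos[of "nat n"] neg[of "nat (- n)"] by (simp add: int_power_def)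
qed

text \<open>A representation \<open>\<rho>\<close> of the group of integers on \<open>H\<close> is given by operators \<open>\<rho> l\<close> that
  map \<open>H\<close> to itself; only their values on \<open>H\<close> matter. The core space of a wavelet is invariant
  under all integer translations, so this applies to core representations below.\<close>

definition unitarily_equivalent ::
  "l2 set \<Rightarrow> (int \<Rightarrow> l2 \<Rightarrow> l2) \<Rightarrow> l2 set \<Rightarrow> (int \<Rightarrow> l2 \<Rightarrow> l2) \<Rightarrow> bool" where
  "unitarily_equivalent H \<rho> K \<sigma> \<longleftrightarrow>
     (\<exists>W. isometric_iso H K W \<and> (\<forall>l. \<forall>f\<in>H. W (\<rho> l f) = \<sigma> l (W f)))"

section \<open>Wavelets\<close>

lift_definition dilation :: "l2 \<Rightarrow> l2" is "\<lambda>f x. complex_of_real (sqrt 2) * f (2 * x)"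
  subgoal for f g using l2_eq_affine[of f g 2 "complex_of_real (sqrt 2)" 0] by simp
  done

lift_definition translation :: "l2 \<Rightarrow> l2" is "\<lambda>f x. f (x + 1)"
  subgoal for f g using l2_eq_affine[of f g 1 1 1] by simp
  done

lemma bij_dilation: "bij dilation"
proof (rule bijI)
  show "inj dilation"
  proof (rule injI)
    show "dilation f = dilation g \<Longrightarrow> f = g" for f g
    proof (transfer, goal_cases)
      case (1 f g)
      then show ?case
        using l2_eq_affine[of "\<lambda>x. complex_of_real (sqrt 2) * f (2 * x)"
            "\<lambda>x. complex_of_real (sqrt 2) * g (2 * x)" "1 / 2" "1 / complex_of_real (sqrt 2)" 0]
        by simp
    qed
  qed
  have "\<exists>g. dilation g = f" for f
  proof (transfer, goal_cases)
    case (1 f)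
    then show ?case
      using l2_eq_affine[of f f "1 / 2" "1 / complex_of_real (sqrt 2)" 0]
      by (intro bexI[of _ "\<lambda>x. 1 / complex_of_real (sqrt 2) * f (1 / 2 * x + 0)"])
        (auto simp: Respects_def)
  qed
  then show "surj dilation" by (metis surjI)
qed

lemma bij_translation: "bij translation"
proof (rule bijI)
  show "inj translation"
  proof (rule injI)
    show "translation f = translation g \<Longrightarrow> f = g" for f g
    proof (transfer, goal_cases)
      case (1 f g)
      then show ?case
        using l2_eq_affine[of "\<lambda>x. f (x + 1)" "\<lambda>x. g (x + 1)" 1 1 "-1"] by simp
    qed
  qed
  have "\<exists>g. translation g = f" for f
  proof (transfer, goal_cases)
    case (1 f)
    then show ?case
      using l2_eq_affine[of f f 1 1 "-1"]
      by (intro bexI[of _ "\<lambda>x. f (x - 1)"]) (auto simp: Respects_def)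
  qed
  then show "surj translation" by (metis surjI)
qed

lift_definition wavelet_system :: "l2 \<Rightarrow> int \<times> int \<Rightarrow> l2"
  is "\<lambda>f (j, n) x. complex_of_real (2 powr (of_int j / 2)) * f (2 powi j * x + of_int n)"
  by (auto intro!: l2_eq_affine)

definition orthonormal_basis :: "('i \<Rightarrow> l2) \<Rightarrow> bool" where
  "orthonormal_basis e \<longleftrightarrow>
     (\<forall>i j. cinner_l2 (e i) (e j) = (if i = j then 1 else 0)) \<and>
     closure (l2.span (range e)) = UNIV"

definition wavelet :: "l2 \<Rightarrow> bool" where
  "wavelet \<psi> \<longleftrightarrow> orthonormal_basis (wavelet_system \<psi>)"

abbreviation dil_trans :: "int \<Rightarrow> int \<Rightarrow> l2 \<Rightarrow> l2" where
  "dil_trans n l f \<equiv> int_power dilation n (int_power translation l f)"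

lemma wavelet_system_eq_dil_trans: "wavelet_system \<psi> (j, n) = dil_trans j n \<psi>"
proof -
  have zero: "wavelet_system \<psi> (0, 0) = \<psi>"
    by transfer simp
  have trans: "translation (wavelet_system \<psi> (0, n)) = wavelet_system \<psi> (0, n + 1)" for n
  proof (transfer, goal_cases)
    case (1 f n)
    then show ?case using l2_eq_affine[of f f 1 1 "of_int (n + 1)"] by (simp add: algebra_simps)
  qed
  have dil: "dilation (wavelet_system \<psi> (j, n)) = wavelet_system \<psi> (j + 1, n)" for j n
  proof (transfer, goal_cases)
    case (1 f j n)
    have "sqrt 2 * 2 powr (of_int j / 2) = 2 powr (of_int (j + 1) / 2)"
      by (simp add: powr_half_sqrt [symmetric] powr_add [symmetric] add_divide_distrib add.commute)
    then have eq: "complex_of_real (sqrt 2) *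
          (complex_of_real (2 powr (of_int j / 2)) * f (2 powi j * (2 * x) + of_int n)) =
        complex_of_real (2 powr (of_int (j + 1) / 2)) * f (2 powi (j + 1) * x + of_int n)" for x
      by (simp add: power_int_add mult.assoc flip: of_real_mult)
    from 1 show ?case
      unfolding prod.case eq by (intro l2_eq_affine) auto
  qed
  have "int_power translation n \<psi> = wavelet_system \<psi> (0, n)"
    using zero trans by (intro int_power_unique[OF bij_translation]) auto
  with dil show ?thesis
    by (intro int_power_unique[OF bij_dilation, symmetric]) auto
qed

definition local_commutant :: "l2 \<Rightarrow> (l2 \<Rightarrow> l2) set" where
  "local_commutant \<psi> =
     {V \<in> bounded_operators. \<forall>n l. V (dil_trans n l \<psi>) = dil_trans n l (V \<psi>)}"

text \<open>For wavelets \<open>\<psi>\<close> and \<open>\<eta>\<close> there is exactly one such \<open>U\<close>, so the universal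
  quantifier over \<open>U\<close> in the definition of an interpolation family refers to that operator.\<close>

definition corresponding_unitary :: "l2 \<Rightarrow> l2 \<Rightarrow> (l2 \<Rightarrow> l2) \<Rightarrow> bool" where
  "corresponding_unitary \<psi> \<eta> U \<longleftrightarrow> unitary_op U \<and> U \<in> local_commutant \<psi> \<and> U \<psi> = \<eta>"

definition interpolation_family :: "l2 set \<Rightarrow> bool" where
  "interpolation_family F \<longleftrightarrow>
     (\<forall>\<psi>\<in>F. wavelet \<psi>) \<and>
     (\<forall>\<psi>\<in>F. \<forall>\<eta>\<in>F. \<forall>U. corresponding_unitary \<psi> \<eta> U \<longrightarrow>
        (\<forall>n. int_power U n \<in> local_commutant \<psi> \<and> int_power U n \<psi> \<in> F))"

definition core_space :: "l2 \<Rightarrow> l2 set" where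
  "core_space \<psi> = closure (l2.span {dil_trans n l \<psi> | n l. n < 0})"

definition core_representation :: "l2 \<Rightarrow> int \<Rightarrow> l2 \<Rightarrow> l2" where
  "core_representation \<psi> l = restrict (int_power translation l) (core_space \<psi>)"

definition core_equivalent :: "l2 \<Rightarrow> l2 \<Rightarrow> bool" where
  "core_equivalent \<psi> \<eta> \<longleftrightarrow>
     unitarily_equivalent (core_space \<psi>) (core_representation \<psi>)
       (core_space \<eta>) (core_representation \<eta>)"

end

theory Submission
  imports Defs
begin

text \<open>
  Let \<open>U\<close> be the unitary with \<open>U \<psi> = \<eta>\<close> that belongs to two members of the family, and put
  \<open>\<psi>\<^sub>k = U\<^sup>k \<psi>\<close> for every integer \<open>k\<close>. Since all powers of \<open>U\<close> lie in the local commutant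
  at \<open>\<psi>\<close>, the operator \<open>U\<close> carries \<open>D\<^sup>n T\<^sup>l \<psi>\<^sub>k\<close> to \<open>D\<^sup>n T\<^sup>l \<psi>\<^sub>k\<^sub>+\<^sub>1\<close>
  (\<open>corresponding_unitary_orbit\<close>). For \<open>n \<ge> 0\<close> one has \<open>T D\<^sup>n = D\<^sup>n T\<^sup>m\<close> with \<open>m = 2\<^sup>n\<close>, so the set
  \<open>A\<close> of all \<open>D\<^sup>n T\<^sup>l \<psi>\<^sub>k\<close> with \<open>n \<ge> 0\<close> and arbitrary \<open>k\<close>, \<open>l\<close> is mapped onto itself by \<open>T\<close>
  as well as by \<open>U\<close>, and \<open>U T = T U\<close> on \<open>A\<close>. By linearity and continuity the two operators commute
  on the closed span \<open>M\<close> of \<open>A\<close>, which both of them map onto itself. For \<open>n < 0\<close> this fails: \<open>T\<close> no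
  longer permutes the wavelet system, and \<open>U\<close> need not commute with \<open>T\<close> on the core spaces.

  Away from \<open>M\<close> the operator \<open>U\<close> can be discarded. Let \<open>W\<close> be \<open>U\<close> on \<open>M\<close> and the identity on the
  orthogonal complement of \<open>M\<close> (\<open>unitary_op_glue\<close>). It is a unitary operator on the whole space
  that commutes with \<open>T\<close> everywhere, and it still maps \<open>D\<^sup>n T\<^sup>l \<psi>\<close> to \<open>D\<^sup>n T\<^sup>l \<eta>\<close> for \<open>n \<ge> 0\<close>. The core
  space of a wavelet is exactly the orthogonal complement of these vectors
  (\<open>core_space_eq_orthogonal_complement\<close>), so \<open>W\<close> maps one core space onto the other and
  intertwines the core representations.

  The argument rests on Hilbert space facts that require completeness: the existence of orthogonal
  projections, and of the unitary operator that matches two orthonormal bases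
  (\<open>orthonormal_bases_unitary\<close>), which provides \<open>U\<close>. Completeness is the Riesz--Fischer theorem.
\<close>


section \<open>Completeness of the space of square-integrable functions\<close>

lemma square_integrable_diff:
  assumes "square_integrable f" "square_integrable g"
  shows "square_integrable (\<lambda>x. f x - g x)"
  using square_integrable_add[OF assms(1) square_integrable_scale[OF assms(2), of "-1"]] by simp

lemma l2_eq_refl: "square_integrable f \<Longrightarrow> l2_eq f f"
  by (simp add: l2_eq_def)

lemma l2_representative:
  obtains f where "square_integrable f" "x = abs_l2 f"
proof -
  have "l2_eq (rep_l2 x) (rep_l2 x)" and "abs_l2 (rep_l2 x) = x"
    using Quotient_rep_reflp[OF Quotient_l2] Quotient_abs_rep[OF Quotient_l2] by auto
  then show ?thesis using that[of "rep_l2 x"] by (auto simp: l2_eq_def)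
qed

lemma abs_l2_diff:
  assumes "square_integrable f" "square_integrable g"
  shows "abs_l2 f - abs_l2 g = abs_l2 (\<lambda>x. f x - g x)"
proof -
  have "abs_l2 f - abs_l2 g = abs_l2 (\<lambda>x. f x + (-1) * g x)"
    unfolding minus_l2_def scaleC_l2.abs_eq[OF l2_eq_refl[OF assms(2)]]
    by (intro plus_l2.abs_eq l2_eq_refl square_integrable_scale assms)
  then show ?thesis by simp
qed

lemma norm_abs_l2:
  assumes "square_integrable f"
  shows "(norm (abs_l2 f))\<^sup>2 = (\<integral>x. (cmod (f x))\<^sup>2 \<partial>lborel)"
proof -
  have "(norm (abs_l2 f))\<^sup>2 = Re (\<integral>x. f x * cnj (f x) \<partial>lborel)"
    using assms by (simp add: power2_norm_eq_inner inner_l2_def cinner_l2.abs_eq l2_eq_refl)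
  also have "(\<integral>x. f x * cnj (f x) \<partial>lborel) = complex_of_real (\<integral>x. (cmod (f x))\<^sup>2 \<partial>lborel)"
    by (simp add: complex_norm_square [symmetric] del: of_real_power)
  finally show ?thesis by simp
qed

lemma nn_integral_abs_l2_diff:
  assumes "square_integrable f" "square_integrable g"
  shows "(\<integral>\<^sup>+x. ennreal ((cmod (f x - g x))\<^sup>2) \<partial>lborel) = ennreal ((dist (abs_l2 f) (abs_l2 g))\<^sup>2)"
proof -
  have d: "square_integrable (\<lambda>x. f x - g x)"
    by (rule square_integrable_diff[OF assms])
  have "(\<integral>\<^sup>+x. ennreal ((cmod (f x - g x))\<^sup>2) \<partial>lborel)
      = ennreal (\<integral>x. (cmod (f x - g x))\<^sup>2 \<partial>lborel)"
    using d unfolding square_integrable_def by (intro nn_integral_eq_integral) auto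
  also have "\<dots> = ennreal ((dist (abs_l2 f) (abs_l2 g))\<^sup>2)"
    by (simp only: dist_norm abs_l2_diff[OF assms] norm_abs_l2[OF d])
  finally show ?thesis .
qed

text \<open>With \<open>a\<^sub>n = |f\<^sub>n - f\<^sub>n\<^sub>+\<^sub>1|\<^sup>2\<close>, the integral of the series of the \<open>2\<^sup>n a\<^sub>n\<close> is at most the sum of the
  \<open>2\<^sup>n (1/4)\<^sup>n\<close>. The series is therefore finite almost everywhere, and at each such point \<open>a\<^sub>n\<close> is
  \<open>O(2\<^sup>-\<^sup>n)\<close>, so that the increments of \<open>f\<^sub>n\<close> are dominated by a geometric series. The weight
  \<open>2\<^sup>n\<close> takes the place of Minkowski's inequality.\<close>

lemma AE_convergent_of_rapidly_Cauchy:
  fixes f :: "nat \<Rightarrow> real \<Rightarrow> complex"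
  assumes sq: "\<And>n. square_integrable (f n)"
    and fast: "\<And>n. dist (abs_l2 (f n)) (abs_l2 (f (Suc n))) \<le> (1/2)^n"
  shows "AE x in lborel. convergent (\<lambda>n. f n x)"
proof -
  note [measurable] = sq[THEN square_integrable_measurable]
  let ?a = "\<lambda>n x. (cmod (f n x - f (Suc n) x))\<^sup>2"
  have "(\<integral>\<^sup>+x. (\<Sum>n. ennreal (2^n * ?a n x)) \<partial>lborel) = (\<Sum>n. \<integral>\<^sup>+x. ennreal (2^n * ?a n x) \<partial>lborel)"
    by (intro nn_integral_suminf) measurable
  also have "\<dots> \<le> (\<Sum>n. ennreal ((1/2)^n))"
  proof (intro suminf_le summableI)
    fix n
    have "(\<integral>\<^sup>+x. ennreal (2^n * ?a n x) \<partial>lborel) = ennreal (2^n) * (\<integral>\<^sup>+x. ennreal (?a n x) \<partial>lborel)"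
      by (subst nn_integral_cmult [symmetric]) (auto simp: ennreal_mult)
    also have "\<dots> = ennreal (2^n * (dist (abs_l2 (f n)) (abs_l2 (f (Suc n))))\<^sup>2)"
      by (simp add: nn_integral_abs_l2_diff sq ennreal_mult)
    also have "\<dots> \<le> ennreal (2^n * ((1/2)^n)\<^sup>2)"
      using fast[of n] by (intro ennreal_leI mult_left_mono power_mono) auto
    also have "(2::real)^n * ((1/2)^n)\<^sup>2 = (1/2)^n"
      by (simp add: power2_eq_square power_divide)
    finally show "(\<integral>\<^sup>+x. ennreal (2^n * ?a n x) \<partial>lborel) \<le> ennreal ((1/2)^n)" .
  qed
  also have "\<dots> < \<infinity>"
    by (subst suminf_ennreal2) (auto intro: summable_geometric)
  finally have "AE x in lborel. (\<Sum>n. ennreal (2^n * ?a n x)) \<noteq> \<infinity>"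
    by (intro nn_integral_PInf_AE) auto
  then show ?thesis
  proof eventually_elim
    case (elim x)
    then have "summable (\<lambda>n. 2^n * ?a n x)"
      by (intro summable_suminf_not_top) auto
    then have "Bseq (\<lambda>n. 2^n * ?a n x)"
      by (intro convergent_imp_Bseq) (auto dest!: summable_LIMSEQ_zero simp: convergent_def)
    then obtain B where B: "B > 0" "\<And>n. 2^n * ?a n x \<le> B"
      by (auto simp: Bseq_def)
    have "cmod (f (Suc n) x - f n x) \<le> sqrt B * (sqrt (1/2))^n" for n
    proof -
      have "?a n x \<le> B * (1/2)^n"
        using B(2)[of n] by (simp add: field_simps power_divide)
      then have "sqrt (?a n x) \<le> sqrt (B * (1/2)^n)" by (rule real_sqrt_le_mono)
      then show ?thesis by (simp add: real_sqrt_mult real_sqrt_power norm_minus_commute)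
    qed
    then have "summable (\<lambda>n. f (Suc n) x - f n x)"
      by (rule summable_comparison_test' [where N = 0, rotated])
        (intro summable_mult summable_geometric, simp)
    then have "convergent (\<lambda>n. \<Sum>i<n. f (Suc i) x - f i x)"
      by (simp add: summable_iff_convergent)
    then have "convergent (\<lambda>n. f n x - f 0 x)"
      by (simp add: sum_lessThan_telescope [of "\<lambda>n. f n x"])
    from convergent_add[OF this convergent_const[of "f 0 x"]]
    show ?case by simp
  qed
qed

text \<open>A subsequence with geometrically small steps converges almost everywhere. Fatou's lemma shows
  that the pointwise limit is square-integrable and bounds the distance to it, which gives
  convergence of the whole Cauchy sequence.\<close>

instance l2 :: complete_space
proof
  fix X :: "nat \<Rightarrow> l2"
  assume X: "Cauchy X"
  have "\<exists>N. \<forall>m\<ge>N. dist (X m) (X N) < (1/2)^Suc k" for k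
    using X[unfolded Cauchy_altdef2, rule_format, of "(1/2)^Suc k"] by auto
  then obtain N where N: "\<And>k m. m \<ge> N k \<Longrightarrow> dist (X m) (X (N k)) < (1/2)^Suc k"
    by metis
  \<comment> \<open>Taking the maximum makes every later index respect the earlier tolerances too.\<close>
  define r where "r k = Max (N ` {..k})" for k
  have rN: "N i \<le> r k" if "i \<le> k" for i k
    using that unfolding r_def by (intro Max_ge) auto
  have rfast: "dist (X (r k)) (X m) < (1/2)^k" if "m \<ge> N k" for k m
    using N[OF rN[of k k]] N[OF that] dist_triangle2[of "X (r k)" "X m" "X (N k)"] by simp
  have "\<exists>f. square_integrable f \<and> X n = abs_l2 f" for n
    by (metis l2_representative)
  then obtain F where F: "\<And>n. square_integrable (F n)" "\<And>n. X n = abs_l2 (F n)"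
    by metis
  define f where "f k = F (r k)" for k
  have sq: "square_integrable (f k)" and Xf: "X (r k) = abs_l2 (f k)" for k
    by (simp_all add: f_def F)
  note [measurable] = sq[THEN square_integrable_measurable]
  have later: "dist (abs_l2 (f k)) (abs_l2 (f m)) \<le> (1/2)^k" if "k \<le> m" for k m
    using rfast[of k "r m"] rN[of k m] that by (simp add: Xf [symmetric])
  define g where "g x = lim (\<lambda>n. f n x)" for x
  have [measurable]: "g \<in> borel_measurable borel"
    unfolding g_def[abs_def] by (intro borel_measurable_lim_metric) auto
  have conv: "AE x in lborel. (\<lambda>n. f n x) \<longlonglongrightarrow> g x"
    using AE_convergent_of_rapidly_Cauchy[of f] sq later[of _ "Suc _"]
    by (auto simp: g_def convergent_LIMSEQ_iff)
  have fatou: "(\<integral>\<^sup>+x. ennreal ((cmod (f k x - g x))\<^sup>2) \<partial>lborel) \<le> ennreal (((1/2)^k)\<^sup>2)" for k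
  proof -
    have "(\<integral>\<^sup>+x. ennreal ((cmod (f k x - g x))\<^sup>2) \<partial>lborel)
        = (\<integral>\<^sup>+x. liminf (\<lambda>n. ennreal ((cmod (f k x - f n x))\<^sup>2)) \<partial>lborel)"
      using conv
    proof (intro nn_integral_cong_AE, eventually_elim)
      case (elim x)
      then have "(\<lambda>n. ennreal ((cmod (f k x - f n x))\<^sup>2)) \<longlonglongrightarrow> ennreal ((cmod (f k x - g x))\<^sup>2)"
        by (intro tendsto_intros)
      then show ?case by (intro lim_imp_Liminf [symmetric]) simp_all
    qed
    also have "\<dots> \<le> liminf (\<lambda>n. \<integral>\<^sup>+x. ennreal ((cmod (f k x - f n x))\<^sup>2) \<partial>lborel)"
      by (intro nn_integral_liminf) measurable
    also have "\<dots> \<le> liminf (\<lambda>n. ennreal (((1/2)^k)\<^sup>2))"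
    proof (intro Liminf_mono eventually_sequentiallyI[of k])
      fix n assume "k \<le> n"
      show "(\<integral>\<^sup>+x. ennreal ((cmod (f k x - f n x))\<^sup>2) \<partial>lborel) \<le> ennreal (((1/2)^k)\<^sup>2)"
        unfolding nn_integral_abs_l2_diff[OF sq sq]
        by (intro ennreal_leI power_mono later \<open>k \<le> n\<close>) simp
    qed
    finally show ?thesis by (simp add: Liminf_const)
  qed
  have diff: "square_integrable (\<lambda>x. f k x - g x)" for k
  proof -
    have "(\<integral>\<^sup>+x. ennreal ((cmod (f k x - g x))\<^sup>2) \<partial>lborel) < \<infinity>"
      using fatou[of k] by (rule order.strict_trans1) simp
    then show ?thesis
      unfolding square_integrable_def by (auto intro!: integrableI_bounded)
  qed
  have gsq: "square_integrable g"
    using square_integrable_diff[OF sq[of 0] diff[of 0]] by simp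
  have near: "dist (abs_l2 (f k)) (abs_l2 g) \<le> (1/2)^k" for k
  proof -
    have "(dist (abs_l2 (f k)) (abs_l2 g))\<^sup>2 \<le> ((1/2)^k)\<^sup>2"
      using fatou[of k] unfolding nn_integral_abs_l2_diff[OF sq gsq] by (subst (asm) ennreal_le_iff) auto
    then show ?thesis by (rule power2_le_imp_le) simp
  qed
  have close: "dist (X m) (abs_l2 g) \<le> 2 * (1/2)^k" if "m \<ge> N k" for k m
    using rfast[OF that] near[of k] dist_triangle3[of "X m" "abs_l2 g" "X (r k)"]
    by (simp add: Xf)
  have "X \<longlonglongrightarrow> abs_l2 g"
  proof (rule metric_LIMSEQ_I)
    fix e :: real assume "e > 0"
    then obtain k where "(1/2)^k < e / 2"
      using real_arch_pow_inv[of "e/2" "1/2"] by auto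
    then have "dist (X n) (abs_l2 g) < e" if "n \<ge> N k" for n
      using close[OF that] by simp
    then show "\<exists>n0. \<forall>n\<ge>n0. dist (X n) (abs_l2 g) < e" by blast
  qed
  then show "convergent X" by (rule convergentI)
qed

section \<open>Orthogonal projections\<close>

text \<open>A minimizing sequence for the distance from \<open>x\<close> to \<open>S\<close> is Cauchy by the parallelogram law,
  because the midpoint of two of its terms again lies in \<open>S\<close>; its limit is the nearest point.\<close>

lemma orthogonal_projection_exists:
  fixes S :: "'a::{real_inner, complete_space} set"
  assumes "subspace S" "closed S"
  shows "\<exists>p\<in>S. \<forall>z\<in>S. inner (x - p) z = 0"
proof -
  let ?q = "\<lambda>y. (norm (x - y))\<^sup>2"
  define d where "d = (INF y\<in>S. ?q y)"
  have bdd: "bdd_below (?q ` S)" by (intro bdd_belowI[of _ 0]) auto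
  have ne: "S \<noteq> {}" using subspace_0[OF assms(1)] by auto
  have d_le: "d \<le> ?q y" if "y \<in> S" for y
    unfolding d_def by (rule cINF_lower[OF bdd that])
  have "\<exists>y\<in>S. ?q y < d + 1 / Suc n" for n
    using cINF_less_iff[OF ne bdd, of "d + 1 / Suc n"] by (simp add: d_def)
  then obtain y where y: "\<And>n. y n \<in> S" "\<And>n. ?q (y n) < d + 1 / Suc n"
    by metis
  have par: "(norm (y m - y n))\<^sup>2 \<le> 2 / Suc m + 2 / Suc n" for m n
  proof -
    have "(1/2) *\<^sub>R (y m + y n) \<in> S"
      using assms(1) y(1) by (intro subspace_scale subspace_add)
    note d_le[OF this]
    moreover have "(norm (y m - y n))\<^sup>2
        = 2 * ?q (y m) + 2 * ?q (y n) - 4 * ?q ((1/2) *\<^sub>R (y m + y n))"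
      by (simp add: power2_norm_eq_inner inner_diff inner_add inner_commute algebra_simps)
    ultimately show ?thesis using y(2)[of m] y(2)[of n] by simp
  qed
  have "Cauchy y"
  proof (rule metric_CauchyI)
    fix e :: real assume e: "e > 0"
    then obtain M where M: "4 / Suc M < e\<^sup>2"
      using reals_Archimedean[of "e\<^sup>2 / 4"] by (auto simp: field_simps)
    have "dist (y m) (y n) < e" if "m \<ge> M" "n \<ge> M" for m n
    proof -
      have "2 / real (Suc m) \<le> 2 / Suc M" "2 / real (Suc n) \<le> 2 / Suc M"
        using that by (auto intro!: divide_left_mono)
      then have "(norm (y m - y n))\<^sup>2 < e\<^sup>2"
        using par[of m n] M by simp
      then show ?thesis using e by (simp add: dist_norm power2_less_imp_less)
    qed
    then show "\<exists>M. \<forall>m\<ge>M. \<forall>n\<ge>M. dist (y m) (y n) < e" by blast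
  qed
  then obtain p where p: "y \<longlonglongrightarrow> p"
    using Cauchy_convergent convergent_def by blast
  then have pS: "p \<in> S"
    using assms(2) y(1) closed_sequentially by blast
  have "(\<lambda>n. ?q (y n)) \<longlonglongrightarrow> ?q p" by (intro tendsto_intros p)
  moreover have "(\<lambda>n. d + 1 / Suc n) \<longlonglongrightarrow> d + 0"
    by (intro tendsto_intros LIMSEQ_inverse_real_of_nat[unfolded inverse_eq_divide])
  ultimately have qp: "?q p \<le> d"
    using y(2) by (intro LIMSEQ_le[of "\<lambda>n. ?q (y n)" _ "\<lambda>n. d + 1 / Suc n"])
      (auto intro: less_imp_le)
  have "inner (x - p) z = 0" if z: "z \<in> S" for z
  proof (cases "z = 0")
    case False
    \<comment> \<open>The multiple of \<open>z\<close> that would bring \<open>p\<close> closest to \<open>x\<close> must vanish.\<close>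
    define t where "t = inner (x - p) z / inner z z"
    have "p + t *\<^sub>R z \<in> S"
      using assms(1) pS z by (intro subspace_scale subspace_add)
    from d_le[OF this] have "?q p \<le> ?q (p + t *\<^sub>R z)" using qp by linarith
    also have "?q (p + t *\<^sub>R z) = ?q p - 2 * t * inner (x - p) z + t\<^sup>2 * inner z z"
      unfolding power2_norm_eq_inner
      by (simp add: inner_diff inner_add inner_commute algebra_simps power2_eq_square)
    also have "\<dots> = ?q p - (inner (x - p) z)\<^sup>2 / inner z z"
      using False by (simp add: t_def power2_eq_square field_simps)
    finally have "(inner (x - p) z)\<^sup>2 / inner z z \<le> 0" by simp
    moreover have "inner z z > 0" using False by simp
    ultimately show ?thesis
      by (metis divide_pos_pos not_less zero_less_power2)
  qed simp
  with pS show ?thesis by blast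
qed

section \<open>Complex Hilbert space geometry\<close>

lemma cinner_l2_add_right: "cinner_l2 f (g + h) = cinner_l2 f g + cinner_l2 f h"
  using cinner_l2_add_left[of g h f] by (metis cinner_l2_commute complex_cnj_add)

lemma cinner_l2_scaleC_right: "cinner_l2 f (c *\<^sub>C g) = cnj c * cinner_l2 f g"
  using cinner_l2_scaleC_left[of c g f] by (metis cinner_l2_commute complex_cnj_mult)

lemma cinner_l2_zero_left [simp]: "cinner_l2 0 g = 0"
  using cinner_l2_scaleC_left[of 0 0 g] by simp

lemma cinner_l2_zero_right [simp]: "cinner_l2 g 0 = 0"
  using cinner_l2_scaleC_right[of g 0 0] by simp

lemma cinner_l2_diff_left: "cinner_l2 (f - g) h = cinner_l2 f h - cinner_l2 g h"
  using cinner_l2_add_left[of "f - g" g h] by simp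

text \<open>The complex inner product is recovered from the real one, so its continuity, and orthogonality to
  complex subspaces, reduce to the real theory.\<close>

lemma cinner_l2_eq_Complex: "cinner_l2 f g = Complex (inner f g) (inner f (\<i> *\<^sub>C g))"
  by (simp add: complex_eq_iff inner_l2_def cinner_l2_scaleC_right)

lemma norm_scaleC_l2: "norm (c *\<^sub>C f) = cmod c * norm f"
proof -
  have "cinner_l2 (c *\<^sub>C f) (c *\<^sub>C f) = complex_of_real ((cmod c)\<^sup>2) * cinner_l2 f f"
    by (simp add: cinner_l2_scaleC_left cinner_l2_scaleC_right complex_norm_square
        del: of_real_power)
  then have "(norm (c *\<^sub>C f))\<^sup>2 = (cmod c * norm f)\<^sup>2"
    by (simp add: power2_norm_eq_inner inner_l2_def power_mult_distrib del: of_real_power)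
  then show ?thesis by (simp add: power2_eq_iff_nonneg)
qed

lemma bounded_linear_scaleC_l2: "bounded_linear (scaleC_l2 c)"
proof (rule bounded_linear_intro[of _ "cmod c"])
  show "c *\<^sub>C (r *\<^sub>R f) = r *\<^sub>R (c *\<^sub>C f)" for r f
    by (simp add: scaleR_l2_def mult.commute)
qed (simp_all add: l2.scale_right_distrib norm_scaleC_l2 mult.commute)

lemma tendsto_scaleC_l2: "(f \<longlongrightarrow> a) F \<Longrightarrow> ((\<lambda>x. c *\<^sub>C f x) \<longlongrightarrow> c *\<^sub>C a) F"
  by (rule bounded_linear.tendsto[OF bounded_linear_scaleC_l2])

lemma tendsto_cinner_l2:
  "(f \<longlongrightarrow> a) F \<Longrightarrow> (g \<longlongrightarrow> b) F \<Longrightarrow> ((\<lambda>x. cinner_l2 (f x) (g x)) \<longlongrightarrow> cinner_l2 a b) F"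
  unfolding cinner_l2_eq_Complex by (intro tendsto_Complex tendsto_inner tendsto_scaleC_l2)

lemma l2_subspace_imp_subspace: "l2.subspace S \<Longrightarrow> subspace S"
  by (simp add: subspace_def l2.subspace_def scaleR_l2_def)

lemma l2_subspace_closure:
  assumes "l2.subspace S" shows "l2.subspace (closure S)"
proof (rule l2.subspaceI)
  show "0 \<in> closure S" using l2.subspace_0[OF assms] closure_subset by blast
next
  fix f g assume "f \<in> closure S" "g \<in> closure S"
  then obtain a b where "\<And>n::nat. a n \<in> S" "a \<longlonglongrightarrow> f" "\<And>n::nat. b n \<in> S" "b \<longlonglongrightarrow> g"
    unfolding closure_sequential by metis
  then show "f + g \<in> closure S"
    unfolding closure_sequential
    by (intro exI[of _ "\<lambda>n. a n + b n"]) (auto intro!: tendsto_add l2.subspace_add[OF assms])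
next
  fix c f assume "f \<in> closure S"
  then obtain a where "\<And>n::nat. a n \<in> S" "a \<longlonglongrightarrow> f"
    unfolding closure_sequential by metis
  then show "c *\<^sub>C f \<in> closure S"
    unfolding closure_sequential
    by (intro exI[of _ "\<lambda>n. c *\<^sub>C a n"]) (auto intro!: tendsto_scaleC_l2 l2.subspace_scale[OF assms])
qed

definition orthogonal_complement :: "l2 set \<Rightarrow> l2 set" where
  "orthogonal_complement S = {f. \<forall>g\<in>S. cinner_l2 f g = 0}"

lemma l2_orthogonal_decomposition:
  assumes "l2.subspace S" "closed S"
  obtains p q where "p \<in> S" "q \<in> orthogonal_complement S" "f = p + q"
proof -
  obtain p where p: "p \<in> S" "\<And>g. g \<in> S \<Longrightarrow> inner (f - p) g = 0"
    using orthogonal_projection_exists[OF l2_subspace_imp_subspace[OF assms(1)] assms(2)] by blast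
  have "cinner_l2 (f - p) g = 0" if "g \<in> S" for g
    using p(2)[OF that] p(2)[OF l2.subspace_scale[OF assms(1) that, of \<i>]]
    by (simp add: cinner_l2_eq_Complex complex_eq_iff)
  then show ?thesis
    using that[of p "f - p"] p(1) by (simp add: orthogonal_complement_def)
qed

lemma subspace_orthogonal_complement: "l2.subspace (orthogonal_complement S)"
  by (rule l2.subspaceI)
    (auto simp: orthogonal_complement_def cinner_l2_add_left cinner_l2_scaleC_left)

lemma orthogonal_to_itself_imp_zero:
  assumes "f \<in> S" "f \<in> orthogonal_complement S" shows "f = 0"
proof -
  have "inner f f = 0" using assms by (simp add: orthogonal_complement_def inner_l2_def)
  then show ?thesis by simp
qed

lemma l2_orthogonal_decomposition_unique:
  assumes S: "l2.subspace S" and "p \<in> S" "p' \<in> S"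
    and "q \<in> orthogonal_complement S" "q' \<in> orthogonal_complement S" and eq: "p + q = p' + q'"
  shows "p = p'" "q = q'"
proof -
  have "p - p' \<in> S" "q' - q \<in> orthogonal_complement S"
    using assms l2.subspace_diff subspace_orthogonal_complement by blast+
  moreover have "p - p' = q' - q"
    using eq by (simp add: algebra_simps)
  ultimately have "p - p' = 0"
    using orthogonal_to_itself_imp_zero by metis
  with eq show "p = p'" "q = q'" by auto
qed

lemma cinner_l2_orthogonal_sum:
  assumes "p \<in> S" "p' \<in> S" "q \<in> orthogonal_complement S" "q' \<in> orthogonal_complement S"
  shows "cinner_l2 (p + q) (p' + q') = cinner_l2 p p' + cinner_l2 q q'"
proof -
  have "cinner_l2 q p' = 0" "cinner_l2 q' p = 0"
    using assms by (auto simp: orthogonal_complement_def)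
  moreover have "cinner_l2 p q' = 0"
    using \<open>cinner_l2 q' p = 0\<close> cinner_l2_commute[of p q'] by simp
  ultimately show ?thesis by (simp add: cinner_l2_add_left cinner_l2_add_right)
qed

text \<open>The vectors orthogonal to a fixed \<open>f\<close> form a closed subspace.\<close>

lemma orthogonal_complement_span_closure:
  "orthogonal_complement (closure (l2.span A)) = orthogonal_complement A"
proof
  have "A \<subseteq> closure (l2.span A)" using l2.span_superset closure_subset by blast
  then show "orthogonal_complement (closure (l2.span A)) \<subseteq> orthogonal_complement A"
    by (auto simp: orthogonal_complement_def)
next
  show "orthogonal_complement A \<subseteq> orthogonal_complement (closure (l2.span A))"
  proof
    fix f assume f: "f \<in> orthogonal_complement A"
    have "l2.subspace {g. cinner_l2 f g = 0}"
      by (rule l2.subspaceI) (auto simp: cinner_l2_add_right cinner_l2_scaleC_right)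
    then have span: "l2.span A \<subseteq> {g. cinner_l2 f g = 0}"
      using f by (intro l2.span_minimal) (auto simp: orthogonal_complement_def)
    have "cinner_l2 f g = 0" if "g \<in> closure (l2.span A)" for g
    proof -
      from that obtain a where a: "\<And>n::nat. a n \<in> l2.span A" "a \<longlonglongrightarrow> g"
        unfolding closure_sequential by metis
      have "(\<lambda>n. cinner_l2 f (a n)) \<longlonglongrightarrow> cinner_l2 f g"
        by (intro tendsto_cinner_l2 tendsto_const a)
      moreover have "(\<lambda>n. cinner_l2 f (a n)) = (\<lambda>n. 0)" using a(1) span by auto
      ultimately show ?thesis by (simp add: LIMSEQ_const_iff)
    qed
    then show "f \<in> orthogonal_complement (closure (l2.span A))"
      by (simp add: orthogonal_complement_def)
  qed
qed

section \<open>Unitary operators\<close>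

lemma isometric_isoD:
  assumes "isometric_iso H K W"
  shows "\<And>f g. f \<in> H \<Longrightarrow> g \<in> H \<Longrightarrow> W (f + g) = W f + W g"
    and "\<And>c f. f \<in> H \<Longrightarrow> W (c *\<^sub>C f) = c *\<^sub>C W f"
    and "\<And>f g. f \<in> H \<Longrightarrow> g \<in> H \<Longrightarrow> cinner_l2 (W f) (W g) = cinner_l2 f g"
    and "W ` H = K"
  using assms unfolding isometric_iso_def by auto

lemma isometric_iso_dist:
  assumes W: "isometric_iso H K W" and H: "l2.subspace H" and "f \<in> H" "g \<in> H"
  shows "dist (W f) (W g) = dist f g"
proof -
  have m: "(-1) *\<^sub>C g \<in> H" using assms by (intro l2.subspace_scale) auto
  have "W (f - g) = W f - W g"
    unfolding minus_l2_def isometric_isoD(1)[OF W \<open>f \<in> H\<close> m] isometric_isoD(2)[OF W \<open>g \<in> H\<close>] ..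
  moreover have "f - g \<in> H" using assms by (intro l2.subspace_diff) auto
  ultimately show ?thesis
    using isometric_isoD(3)[OF W, of "f - g" "f - g"]
    by (simp add: dist_norm norm_eq_sqrt_inner inner_l2_def)
qed

lemma unitary_op_dist: "unitary_op W \<Longrightarrow> dist (W f) (W g) = dist f g"
  by (rule isometric_iso_dist) (auto simp: l2.subspace_UNIV)

lemma unitary_op_bij: "unitary_op W \<Longrightarrow> bij W"
  using unitary_op_dist[of W] isometric_isoD(4)[of UNIV UNIV W]
  by (auto simp: bij_def inj_def) (metis dist_eq_0_iff)

lemma unitary_op_linear:
  "unitary_op W \<Longrightarrow> Vector_Spaces.linear scaleC_l2 scaleC_l2 W"
  by (auto simp: Vector_Spaces.linear_iff isometric_isoD l2.vector_space_axioms)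

lemma unitary_op_bounded_linear:
  assumes "unitary_op W" shows "bounded_linear W"
proof (rule bounded_linear_intro[of _ 1])
  show "norm (W f) \<le> norm f * 1" for f
    using isometric_isoD(3)[OF assms, of f f] by (simp add: norm_eq_sqrt_inner inner_l2_def)
qed (auto simp: scaleR_l2_def isometric_isoD[OF assms])

lemma unitary_op_inv:
  assumes "unitary_op W" shows "unitary_op (inv W)"
proof -
  note bij = unitary_op_bij[OF assms]
  have inv: "W (inv W f) = f" "inv W (W f) = f" for f
    using bij by (simp_all add: bij_is_surj surj_f_inv_f bij_is_inj)
  have "inv W (f + g) = inv W f + inv W g" "inv W (c *\<^sub>C f) = c *\<^sub>C inv W f"
    "cinner_l2 (inv W f) (inv W g) = cinner_l2 f g" for f g c
    using isometric_isoD[OF assms] inv by (metis UNIV_I)+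
  moreover have "range (inv W) = UNIV" using bij by (simp add: bij_is_inj inj_imp_surj_inv)
  ultimately show ?thesis by (simp add: isometric_iso_def)
qed

lemma unitary_op_image_closed_span_subset:
  assumes "unitary_op W" "W ` A \<subseteq> closure (l2.span B)"
  shows "W ` closure (l2.span A) \<subseteq> closure (l2.span B)"
proof -
  have "W ` closure (l2.span A) \<subseteq> closure (W ` l2.span A)"
    by (rule closure_bounded_linear_image_subset[OF unitary_op_bounded_linear[OF assms(1)]])
  also have "W ` l2.span A = l2.span (W ` A)"
    by (rule module_hom.span_image[symmetric])
      (simp add: module_hom_iff_linear unitary_op_linear[OF assms(1)])
  also have "closure (l2.span (W ` A)) \<subseteq> closure (l2.span B)"
    by (intro closure_minimal l2.span_minimal assms(2) l2_subspace_closure l2.subspace_span closed_closure)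
  finally show ?thesis .
qed

lemma unitary_op_image_closed_span:
  assumes "unitary_op W" "W ` A = A"
  shows "W ` closure (l2.span A) = closure (l2.span A)" (is "W ` ?M = ?M")
proof
  have A: "A \<subseteq> ?M" using l2.span_superset closure_subset by blast
  then show "W ` ?M \<subseteq> ?M"
    using assms by (intro unitary_op_image_closed_span_subset) auto
  have "inv W ` A = A"
    using image_inv_f_f[OF bij_is_inj[OF unitary_op_bij[OF assms(1)]], of A] assms(2) by simp
  then have "inv W ` ?M \<subseteq> ?M"
    using A by (intro unitary_op_image_closed_span_subset unitary_op_inv assms(1)) auto
  then have "W ` inv W ` ?M \<subseteq> W ` ?M" by (rule image_mono)
  then show "?M \<subseteq> W ` ?M"
    by (simp add: image_f_inv_f bij_is_surj unitary_op_bij[OF assms(1)])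
qed

lemma unitary_op_orthogonal_complement:
  assumes W: "unitary_op W"
  shows "W ` orthogonal_complement A = orthogonal_complement (W ` A)"
proof
  show "W ` orthogonal_complement A \<subseteq> orthogonal_complement (W ` A)"
    by (auto simp: orthogonal_complement_def isometric_isoD(3)[OF W])
  show "orthogonal_complement (W ` A) \<subseteq> W ` orthogonal_complement A"
  proof
    fix g assume g: "g \<in> orthogonal_complement (W ` A)"
    obtain f where "g = W f" using isometric_isoD(4)[OF W] by blast
    with g show "g \<in> W ` orthogonal_complement A"
      by (auto simp: orthogonal_complement_def isometric_isoD(3)[OF W])
  qed
qed

text \<open>The decomposition \<open>f = p + q\<close> along \<open>M\<close> is unique, so \<open>W\<close> is well defined and linear; it is
  isometric because \<open>U p\<close> stays in \<open>M\<close> and hence orthogonal to \<open>q\<close>, and onto because \<open>U\<close> maps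
  \<open>M\<close> onto itself.\<close>

lemma unitary_op_glue:
  assumes U: "unitary_op U" and M: "l2.subspace M" "closed M" "U ` M = M"
  obtains W where "unitary_op W" "\<And>p q. p \<in> M \<Longrightarrow> q \<in> orthogonal_complement M \<Longrightarrow> W (p + q) = U p + q"
proof -
  let ?N = "orthogonal_complement M"
  have "\<forall>f. \<exists>p q. p \<in> M \<and> q \<in> ?N \<and> f = p + q"
    using l2_orthogonal_decomposition[OF M(1,2)] by metis
  then obtain P Q where PQ: "\<And>f. P f \<in> M" "\<And>f. Q f \<in> ?N" "\<And>f. f = P f + Q f"
    by metis
  define W where "W f = U (P f) + Q f" for f
  have W: "W (p + q) = U p + q" if "p \<in> M" "q \<in> ?N" for p q
    using l2_orthogonal_decomposition_unique[OF M(1) PQ(1) that(1) PQ(2) that(2) PQ(3)[symmetric]]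
    by (simp add: W_def)
  note sub = M(1) subspace_orthogonal_complement[of M]
  note UD = isometric_isoD[OF U, simplified]
  have "W (f + g) = W f + W g" for f g
  proof -
    have "f + g = (P f + P g) + (Q f + Q g)"
      using PQ(3)[of f] PQ(3)[of g] by (metis add.assoc add.left_commute)
    moreover have "W ((P f + P g) + (Q f + Q g)) = U (P f + P g) + (Q f + Q g)"
      by (intro W l2.subspace_add sub PQ)
    ultimately show ?thesis by (simp add: W_def UD algebra_simps)
  qed
  moreover have "W (c *\<^sub>C f) = c *\<^sub>C W f" for c f
  proof -
    have "c *\<^sub>C f = c *\<^sub>C P f + c *\<^sub>C Q f"
      using PQ(3)[of f] by (metis l2.scale_right_distrib)
    moreover have "W (c *\<^sub>C P f + c *\<^sub>C Q f) = U (c *\<^sub>C P f) + c *\<^sub>C Q f"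
      by (intro W l2.subspace_scale sub PQ)
    ultimately show ?thesis by (simp add: W_def UD l2.scale_right_distrib)
  qed
  moreover have "cinner_l2 (W f) (W g) = cinner_l2 f g" for f g
  proof -
    have UM: "U (P h) \<in> M" for h using M(3) PQ(1) by blast
    have "cinner_l2 (W f) (W g) = cinner_l2 (U (P f)) (U (P g)) + cinner_l2 (Q f) (Q g)"
      unfolding W_def by (intro cinner_l2_orthogonal_sum[of _ M] UM PQ)
    also have "\<dots> = cinner_l2 (P f + Q f) (P g + Q g)"
      unfolding UD(3) by (intro cinner_l2_orthogonal_sum[of _ M, symmetric] PQ)
    finally show ?thesis using PQ(3) by metis
  qed
  moreover have "range W = UNIV"
  proof -
    have "g \<in> range W" for g
    proof -
      obtain m where m: "m \<in> M" "U m = P g" using M(3) PQ(1)[of g] by (metis imageE)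
      then have "W (m + Q g) = g" using W[OF m(1) PQ(2)] PQ(3)[of g] by simp
      then show ?thesis by (metis rangeI)
    qed
    then show ?thesis by blast
  qed
  ultimately have "unitary_op W" by (simp add: isometric_iso_def)
  with W show ?thesis by (rule that[rotated])
qed

text \<open>An isometry is uniformly continuous and so extends to the closure of its domain; all identities
  pass to limits. The extension is onto because preimages of a convergent sequence in \<open>K\<close> form a
  Cauchy sequence.\<close>

lemma isometric_iso_extend:
  assumes U: "isometric_iso S K U" and S: "l2.subspace S" "closure S = UNIV" and K: "closure K = UNIV"
  obtains W where "unitary_op W" "\<And>f. f \<in> S \<Longrightarrow> W f = U f"
proof -
  have "uniformly_continuous_on S U"
    unfolding uniformly_continuous_on_def using isometric_iso_dist[OF U S(1)] by metis
  then obtain W where W: "uniformly_continuous_on UNIV W" "\<And>f. f \<in> S \<Longrightarrow> U f = W f"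
    using S(2) uniformly_continuous_on_extension_on_closure[of S U] by metis
  have "continuous_on UNIV W" by (rule uniformly_continuous_imp_continuous[OF W(1)])
  then have "isCont W f" for f by (simp add: continuous_on_eq_continuous_at)
  then have cont: "(\<lambda>n. W (a n)) \<longlonglongrightarrow> W f" if "a \<longlonglongrightarrow> f" for a :: "nat \<Rightarrow> l2" and f
    using that by (rule isCont_tendsto_compose)
  have approx: "\<exists>a. (\<forall>n::nat. a n \<in> S) \<and> a \<longlonglongrightarrow> f" for f
    using S(2) closure_sequential[of f S] by auto
  note UD = isometric_isoD[OF U]
  have "W (f + g) = W f + W g" for f g
  proof -
    obtain a b where ab: "\<And>n. a n \<in> S" "a \<longlonglongrightarrow> f" "\<And>n. b n \<in> S" "b \<longlonglongrightarrow> g"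
      using approx by metis
    have "W (a n + b n) = W (a n) + W (b n)" for n
      using ab(1,3)[of n] by (simp add: UD(1) l2.subspace_add[OF S(1)] flip: W(2))
    then have "(\<lambda>n. W (a n + b n)) \<longlonglongrightarrow> W f + W g"
      using tendsto_add[OF cont[OF ab(2)] cont[OF ab(4)]] by simp
    with cont[OF tendsto_add[OF ab(2,4)]] show ?thesis by (rule LIMSEQ_unique)
  qed
  moreover have "W (c *\<^sub>C f) = c *\<^sub>C W f" for c f
  proof -
    obtain a where a: "\<And>n. a n \<in> S" "a \<longlonglongrightarrow> f" using approx by metis
    have "W (c *\<^sub>C a n) = c *\<^sub>C W (a n)" for n
      using a(1)[of n] by (simp add: UD(2) l2.subspace_scale[OF S(1)] flip: W(2))
    then have "(\<lambda>n. W (c *\<^sub>C a n)) \<longlonglongrightarrow> c *\<^sub>C W f"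
      using tendsto_scaleC_l2[OF cont[OF a(2)], of c] by simp
    with cont[OF tendsto_scaleC_l2[OF a(2)]] show ?thesis by (rule LIMSEQ_unique)
  qed
  moreover have "cinner_l2 (W f) (W g) = cinner_l2 f g" for f g
  proof -
    obtain a b where ab: "\<And>n. a n \<in> S" "a \<longlonglongrightarrow> f" "\<And>n. b n \<in> S" "b \<longlonglongrightarrow> g"
      using approx by metis
    have "cinner_l2 (W (a n)) (W (b n)) = cinner_l2 (a n) (b n)" for n
      using ab(1,3)[of n] by (simp add: UD(3) flip: W(2))
    then have "(\<lambda>n. cinner_l2 (a n) (b n)) \<longlonglongrightarrow> cinner_l2 (W f) (W g)"
      using tendsto_cinner_l2[OF cont[OF ab(2)] cont[OF ab(4)]] by simp
    then show ?thesis
      using tendsto_cinner_l2[OF ab(2,4)] by (rule LIMSEQ_unique)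
  qed
  moreover have "range W = UNIV"
  proof -
    have "g \<in> range W" for g
    proof -
      obtain b where b: "\<And>n::nat. b n \<in> K" "b \<longlonglongrightarrow> g"
        using K closure_sequential[of g K] by blast
      have "\<exists>f. f \<in> S \<and> b n = U f" for n
        using b(1)[of n] UD(4) by blast
      then obtain a where a: "\<And>n. a n \<in> S" "\<And>n. b n = U (a n)"
        by metis
      have "dist (a m) (a n) = dist (b m) (b n)" for m n
        unfolding a(2) by (rule isometric_iso_dist[OF U S(1) a(1) a(1), symmetric])
      then have "Cauchy a"
        using LIMSEQ_imp_Cauchy[OF b(2)] by (simp only: Cauchy_def)
      then obtain f where f: "a \<longlonglongrightarrow> f" using Cauchy_convergent convergent_def by blast
      have "b = (\<lambda>n. W (a n))" using a(2) W(2)[OF a(1)] by (intro ext) metis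
      with b(2) have "(\<lambda>n. W (a n)) \<longlonglongrightarrow> g" by metis
      with cont[OF f] have "W f = g" by (rule LIMSEQ_unique)
      then show ?thesis by blast
    qed
    then show ?thesis by blast
  qed
  ultimately have "unitary_op W" by (simp add: isometric_iso_def)
  then show ?thesis using that W(2) by metis
qed

interpretation l2_pair: vector_space_pair scaleC_l2 scaleC_l2 ..

lemma orthonormal_independent:
  assumes "\<And>i j. cinner_l2 (e i) (e j) = (if i = j then 1 else 0)"
  shows "l2.independent (range e)"
  unfolding l2.independent_explicit_module
proof (intro allI impI)
  fix t u v assume t: "finite t" "t \<subseteq> range e" "(\<Sum>w\<in>t. u w *\<^sub>C w) = 0" "v \<in> t"
  have sum: "cinner_l2 (\<Sum>w\<in>s. u w *\<^sub>C w) v = (\<Sum>w\<in>s. u w * cinner_l2 w v)" if "finite s" for s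
    using that by induction (auto simp: cinner_l2_add_left cinner_l2_scaleC_left)
  have "cinner_l2 w v = (if w = v then 1 else 0)" if w: "w \<in> t" for w
  proof -
    obtain i j where "w = e i" "v = e j" using t(2,4) w by blast
    with assms show ?thesis by (metis zero_neq_one)
  qed
  then have "(\<Sum>w\<in>t. u w * cinner_l2 w v) = (\<Sum>w\<in>t. if w = v then u w else 0)"
    by (intro sum.cong) auto
  with sum[OF t(1)] t show "u v = 0" by simp
qed

text \<open>Linear independence defines the operator on the algebraic span of the first basis, where it
  preserves inner products because it does so on basis vectors. Both spans are dense.\<close>

lemma orthonormal_bases_unitary:
  assumes e: "orthonormal_basis e" and e': "orthonormal_basis e'"
  obtains W where "unitary_op W" "\<And>i. W (e i) = e' i"
proof -
  have on: "\<And>i j. cinner_l2 (e i) (e j) = (if i = j then 1 else 0)"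
    "\<And>i j. cinner_l2 (e' i) (e' j) = (if i = j then 1 else 0)"
    using e e' by (auto simp: orthonormal_basis_def)
  have inj: "inj e" using on(1) by (metis injI zero_neq_one)
  have ind: "l2.independent (range e)" using on(1) by (rule orthonormal_independent)
  define U where "U = l2_pair.construct (range e) (e' \<circ> inv e)"
  have lin: "Vector_Spaces.linear scaleC_l2 scaleC_l2 U"
    using l2_pair.linear_construct[OF ind] by (simp add: U_def)
  have Ue: "U (e i) = e' i" for i
    using l2_pair.construct_basis[OF ind, of "e i"] inj by (simp add: U_def)
  have add: "U (f + g) = U f + U g" and scale: "U (c *\<^sub>C f) = c *\<^sub>C U f" for f g c
    using lin by (auto simp: Vector_Spaces.linear_iff)
  have zero: "U 0 = 0" using scale[of 0 0] by simp
  have basis: "cinner_l2 (U f) (U (e j)) = cinner_l2 f (e j)" if "f \<in> l2.span (range e)" for f j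
    using that
  proof (induction rule: l2.span_induct_alt)
    case (step c x y)
    then show ?case by (auto simp: add scale cinner_l2_add_left cinner_l2_scaleC_left Ue on)
  qed (simp add: zero)
  have "cinner_l2 (U f) (U g) = cinner_l2 f g"
    if f: "f \<in> l2.span (range e)" and "g \<in> l2.span (range e)" for f g
    using that(2)
  proof (induction rule: l2.span_induct_alt)
    case (step c x y)
    then show ?case
      using basis[OF f] by (auto simp: add scale cinner_l2_add_right cinner_l2_scaleC_right)
  qed (simp add: zero)
  moreover have "U ` l2.span (range e) = l2.span (range e')"
    using module_hom.span_image[of scaleC_l2 scaleC_l2 U "range e"] lin Ue
    by (simp add: module_hom_iff_linear image_image)
  ultimately have "isometric_iso (l2.span (range e)) (l2.span (range e')) U"
    by (simp add: isometric_iso_def add scale)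
  then obtain W where W: "unitary_op W" "\<And>f. f \<in> l2.span (range e) \<Longrightarrow> W f = U f"
    using isometric_iso_extend l2.subspace_span e e' by (metis orthonormal_basis_def)
  then show ?thesis using that[of W] Ue by (simp add: l2.span_base)
qed

section \<open>Wavelet systems and core spaces\<close>

lemma wavelet_system_origin: "wavelet_system f (0, 0) = f"
  by (simp add: wavelet_system_eq_dil_trans int_power_def)

text \<open>The relation \<open>T D\<^sup>j = D\<^sup>j T\<^sup>m\<close> with \<open>m = 2\<^sup>j\<close>, valid inside the wavelet system only for
  \<open>j \<ge> 0\<close>: for negative \<open>j\<close> the shift would not be an integer.\<close>

lemma translation_wavelet_system:
  assumes "0 \<le> j"
  shows "translation (wavelet_system f (j, n)) = wavelet_system f (j, n + 2 ^ nat j)"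
  using assms
proof (transfer, goal_cases)
  case (1 j f n)
  have "(2::real) powi j * (x + 1) + of_int n = 2 powi j * x + of_int (n + 2 ^ nat j)" for x
    using 1 by (simp add: power_int_def algebra_simps)
  with 1 show ?case unfolding prod.case by (simp only:) (auto intro!: l2_eq_affine)
qed

lemma translation_wavelet_system_image:
  assumes "0 \<le> j"
  shows "translation ` range (\<lambda>n. wavelet_system f (j, n)) = range (\<lambda>n. wavelet_system f (j, n))"
proof -
  have "translation ` range (\<lambda>n. wavelet_system f (j, n))
      = (\<lambda>n. wavelet_system f (j, n)) ` range (\<lambda>n. n + 2 ^ nat j)"
    by (simp only: image_image translation_wavelet_system[OF assms])
  also have "range (\<lambda>n::int. n + 2 ^ nat j) = UNIV" by (rule surj_plus_right)
  finally show ?thesis .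
qed

lemma unitary_op_translation: "unitary_op translation"
proof -
  have "translation (f + g) = translation f + translation g" for f g
    by transfer (auto simp: l2_eq_def intro!: square_integrable_add
        square_integrable_affine[of _ 1 1 1, simplified])
  moreover have "translation (c *\<^sub>C f) = c *\<^sub>C translation f" for c f
    by transfer (auto simp: l2_eq_def intro!: square_integrable_scale
        square_integrable_affine[of _ 1 1 1, simplified])
  moreover have "cinner_l2 (translation f) (translation g) = cinner_l2 f g" for f g
  proof (transfer, goal_cases)
    case (1 f g)
    show ?case
      using lborel_integral_real_affine[of 1 "\<lambda>x. f x * cnj (g x)" 1] by (simp add: add.commute)
  qed
  moreover have "range translation = UNIV" using bij_translation by (simp add: bij_is_surj)
  ultimately show ?thesis by (simp add: isometric_iso_def)
qed

lemma local_commutant_wavelet_system: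
  "V \<in> local_commutant f \<Longrightarrow> V (wavelet_system f p) = wavelet_system (V f) p"
  by (cases p) (auto simp: local_commutant_def wavelet_system_eq_dil_trans)

lemma corresponding_unitary_exists:
  assumes "wavelet \<psi>" "wavelet \<eta>"
  obtains U where "corresponding_unitary \<psi> \<eta> U"
proof -
  obtain U where U: "unitary_op U" "\<And>p. U (wavelet_system \<psi> p) = wavelet_system \<eta> p"
    using orthonormal_bases_unitary assms unfolding wavelet_def by metis
  have "U \<psi> = \<eta>" using U(2)[of "(0, 0)"] by (simp add: wavelet_system_origin)
  moreover have "U \<in> local_commutant \<psi>"
    using U(2) \<open>U \<psi> = \<eta>\<close> unitary_op_linear[OF U(1)] unitary_op_bounded_linear[OF U(1)]
    by (simp add: local_commutant_def bounded_operators_def flip: wavelet_system_eq_dil_trans)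
  ultimately show ?thesis using that U(1) by (simp add: corresponding_unitary_def)
qed

lemma int_power_add_one:
  assumes "bij f"
  shows "int_power f (n + 1) x = f (int_power f n x)"
proof (cases "0 \<le> n")
  case True
  then show ?thesis by (simp add: int_power_def nat_add_distrib)
next
  case False
  then obtain m where m: "n = - int (Suc m)"
    by (metis int_cases not_less zero_le_imp_eq_int negD not_le)
  have "f (inv f y) = y" for y using assms by (simp add: bij_is_surj surj_f_inv_f)
  then show ?thesis by (cases "m = 0") (simp_all add: int_power_def m nat_add_distrib)
qed

text \<open>Orthonormality gives one inclusion. Conversely, a vector orthogonal to the part of the basis with
  \<open>n \<ge> 0\<close> differs from its projection to the core space by a vector orthogonal to the whole
  basis, which is zero. This describes the core space by the scales \<open>n \<ge> 0\<close>, the ones on which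
  translations act well.\<close>

lemma core_space_eq_orthogonal_complement:
  assumes "wavelet \<psi>"
  shows "core_space \<psi> = orthogonal_complement {wavelet_system \<psi> (n, l) | n l. 0 \<le> n}"
    (is "_ = orthogonal_complement ?P")
proof -
  let ?B = "{wavelet_system \<psi> (n, l) | n l. n < 0}"
  have core: "core_space \<psi> = closure (l2.span ?B)"
    by (simp add: core_space_def wavelet_system_eq_dil_trans)
  have on: "\<And>p q. cinner_l2 (wavelet_system \<psi> p) (wavelet_system \<psi> q) = (if p = q then 1 else 0)"
    and dense: "closure (l2.span (range (wavelet_system \<psi>))) = UNIV"
    using assms unfolding wavelet_def orthonormal_basis_def by blast+
  have "?P \<subseteq> orthogonal_complement ?B"
    using on by (auto simp: orthogonal_complement_def)
  then have P: "?P \<subseteq> orthogonal_complement (core_space \<psi>)"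
    by (simp add: core orthogonal_complement_span_closure)
  have core_P: "core_space \<psi> \<subseteq> orthogonal_complement ?P"
    using P cinner_l2_commute unfolding orthogonal_complement_def
    by (smt (verit) complex_cnj_zero mem_Collect_eq subset_iff)
  have sub: "l2.subspace (core_space \<psi>)" "closed (core_space \<psi>)"
    by (simp_all add: core l2_subspace_closure l2.subspace_span)
  have "f \<in> core_space \<psi>" if f: "f \<in> orthogonal_complement ?P" for f
  proof -
    obtain p q where pq: "p \<in> core_space \<psi>" "q \<in> orthogonal_complement (core_space \<psi>)" "f = p + q"
      using l2_orthogonal_decomposition[OF sub] by metis
    have "q \<in> orthogonal_complement ?P"
      using l2.subspace_diff[OF subspace_orthogonal_complement f, of p] pq core_P by auto
    moreover have "q \<in> orthogonal_complement ?B"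
      using pq(2) by (simp add: core orthogonal_complement_span_closure)
    moreover have "wavelet_system \<psi> (n, l) \<in> ?P \<union> ?B" for n l
    proof (cases "0 \<le> n")
      case False
      then have "n < 0" by simp
      then show ?thesis by blast
    qed blast
    then have "range (wavelet_system \<psi>) \<subseteq> ?P \<union> ?B" by auto
    moreover have "orthogonal_complement A \<inter> orthogonal_complement B \<subseteq> orthogonal_complement C"
      if "C \<subseteq> A \<union> B" for A B C
      using that by (auto simp: orthogonal_complement_def)
    ultimately have "q \<in> orthogonal_complement (range (wavelet_system \<psi>))"
      by (meson IntI subsetD)
    then have "q \<in> orthogonal_complement UNIV"
      using orthogonal_complement_span_closure[of "range (wavelet_system \<psi>)"] dense by simp
    then have "q = 0" by (rule orthogonal_to_itself_imp_zero[OF UNIV_I])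
    with pq show ?thesis by simp
  qed
  with core_P show ?thesis by blast
qed

section \<open>Core equivalence\<close>

text \<open>A unitary operator respects orthogonal complements, so it maps one core space onto the other as
  soon as it matches the two wavelet systems at the scales \<open>n \<ge> 0\<close>.\<close>

lemma core_equivalent_by_unitary:
  assumes W: "unitary_op W" and comm: "\<And>f. W (translation f) = translation (W f)"
    and \<psi>: "wavelet \<psi>" and \<eta>: "wavelet \<eta>"
    and wav: "\<And>n l. 0 \<le> n \<Longrightarrow> W (wavelet_system \<psi> (n, l)) = wavelet_system \<eta> (n, l)"
  shows "core_equivalent \<psi> \<eta>"
proof -
  have "W ` {wavelet_system \<psi> (n, l) | n l. 0 \<le> n} = {wavelet_system \<eta> (n, l) | n l. 0 \<le> n}"
  proof -
    have "W ` (\<lambda>(n, l). wavelet_system \<psi> (n, l)) ` ({0..} \<times> UNIV)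
        = (\<lambda>(n, l). wavelet_system \<eta> (n, l)) ` ({0..} \<times> UNIV)"
      unfolding image_image by (intro image_cong) (auto simp: wav)
    moreover have "{wavelet_system f (n, l) | n l. 0 \<le> n}
        = (\<lambda>(n, l). wavelet_system f (n, l)) ` ({0..} \<times> UNIV)" for f by auto
    ultimately show ?thesis by simp
  qed
  then have img: "W ` core_space \<psi> = core_space \<eta>"
    by (simp add: core_space_eq_orthogonal_complement \<psi> \<eta> unitary_op_orthogonal_complement[OF W])
  then have "isometric_iso (core_space \<psi>) (core_space \<eta>) W"
    using isometric_isoD[OF W] by (simp add: isometric_iso_def)
  moreover have "int_power translation l (W f) = W (int_power translation l f)" for l f
    by (rule int_power_unique[OF bij_translation])
      (simp_all add: int_power_def[of _ 0] int_power_add_one[OF bij_translation] comm)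
  ultimately show ?thesis
    unfolding core_equivalent_def unitarily_equivalent_def core_representation_def
    using img by (intro exI[of _ W]) auto
qed

text \<open>Both \<open>U\<^sup>k\<close> and \<open>U\<^sup>k\<^sup>+\<^sup>1\<close> commute past \<open>D\<^sup>n T\<^sup>l\<close> at \<open>\<psi>\<close>, and \<open>U U\<^sup>k = U\<^sup>k\<^sup>+\<^sup>1\<close>.\<close>

lemma corresponding_unitary_orbit:
  assumes U: "corresponding_unitary \<psi> \<eta> U" and pow: "\<And>n. int_power U n \<in> local_commutant \<psi>"
  shows "U (wavelet_system (int_power U k \<psi>) p) = wavelet_system (int_power U (k + 1) \<psi>) p"
proof -
  have "bij U" using U by (simp add: corresponding_unitary_def unitary_op_bij)
  then have "U (int_power U k f) = int_power U (k + 1) f" for f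
    by (simp add: int_power_add_one)
  then show ?thesis
    using local_commutant_wavelet_system[OF pow] by metis
qed

text \<open>The unitary \<open>W\<close> agrees with \<open>U\<close> on the closed span \<open>M\<close> of the non-negative scales of the whole
  two-sided orbit \<open>\<phi>\<close>. With \<open>k \<ge> 0\<close> alone, \<open>U\<close> would map \<open>M\<close> into itself but
  perhaps not onto, and \<open>W\<close> could fail to be onto.\<close>

lemma core_equivalent_if_powers_in_local_commutant:
  assumes \<psi>: "wavelet \<psi>" and \<eta>: "wavelet \<eta>"
    and U: "corresponding_unitary \<psi> \<eta> U" and pow: "\<And>n. int_power U n \<in> local_commutant \<psi>"
  shows "core_equivalent \<psi> \<eta>"
proof -
  have uU: "unitary_op U" and U\<psi>: "U \<psi> = \<eta>"
    using U by (auto simp: corresponding_unitary_def)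
  define \<phi> where "\<phi> k = int_power U k \<psi>" for k
  have \<phi>: "\<phi> 0 = \<psi>" "\<phi> 1 = \<eta>"
    by (simp_all add: \<phi>_def int_power_def U\<psi>)
  have shift: "U (wavelet_system (\<phi> k) p) = wavelet_system (\<phi> (k + 1)) p" for k p
    unfolding \<phi>_def by (rule corresponding_unitary_orbit[OF U pow])
  define P where "P k = (\<Union>n\<in>{0..}. range (\<lambda>l. wavelet_system (\<phi> k) (n, l)))" for k
  define A where "A = (\<Union>k. P k)"
  define M where "M = closure (l2.span A)"
  have A: "wavelet_system (\<phi> k) (n, l) \<in> A" if "0 \<le> n" for k n l
    using that by (auto simp: A_def P_def)
  have AM: "A \<subseteq> M" unfolding M_def using l2.span_superset closure_subset by blast
  have M: "l2.subspace M" "closed M"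
    by (simp_all add: M_def l2_subspace_closure l2.subspace_span)
  have "U ` P k = P (k + 1)" for k
    unfolding P_def image_UN by (simp add: image_image shift)
  then have "U ` A = \<Union> (P ` range (\<lambda>k. k + 1))"
    unfolding A_def image_UN by (simp only: image_image)
  also have "range (\<lambda>k::int. k + 1) = UNIV" by (rule surj_plus_right)
  finally have UA: "U ` A = A" by (simp add: A_def)
  have "translation ` P k = P k" for k
    unfolding P_def image_UN by (simp add: translation_wavelet_system_image)
  then have TA: "translation ` A = A"
    unfolding A_def image_UN by simp
  have UM: "U ` M = M" and TM: "translation ` M = M"
    unfolding M_def by (rule unitary_op_image_closed_span; fact uU UA unitary_op_translation TA)+
  have commA: "U (translation f) = translation (U f)" if "f \<in> A" for f
    using that by (auto simp: A_def P_def translation_wavelet_system shift)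
  have comm: "U (translation f) = translation (U f)" if "f \<in> M" for f
  proof -
    note bl = unitary_op_bounded_linear[OF uU] unitary_op_bounded_linear[OF unitary_op_translation]
    have "closed {f. U (translation f) = translation (U f)}"
      using bl by (intro closed_Collect_eq linear_continuous_on bounded_linear_compose[of U translation, OF bl])
        (auto intro: linear_continuous_on bounded_linear_compose)
    moreover have "l2.subspace {f. U (translation f) = translation (U f)}"
      using isometric_isoD[OF uU] isometric_isoD[OF unitary_op_translation]
      by (intro l2.subspaceI) (auto simp: linear_0 bounded_linear.linear bl)
    ultimately have "M \<subseteq> {f. U (translation f) = translation (U f)}"
      unfolding M_def using commA by (intro closure_minimal l2.span_minimal) auto
    with that show ?thesis by blast
  qed
  obtain W where W: "unitary_op W"
    "\<And>p q. p \<in> M \<Longrightarrow> q \<in> orthogonal_complement M \<Longrightarrow> W (p + q) = U p + q"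
    using unitary_op_glue[OF uU M UM] by metis
  have W_M: "W p = U p" if "p \<in> M" for p
    using W(2)[OF that, of 0] by (simp add: orthogonal_complement_def)
  have "W (translation f) = translation (W f)" for f
  proof -
    obtain p q where pq: "p \<in> M" "q \<in> orthogonal_complement M" "f = p + q"
      using l2_orthogonal_decomposition[OF M] by metis
    have T: "translation p \<in> M" "translation q \<in> orthogonal_complement M"
      using TM unitary_op_orthogonal_complement[OF unitary_op_translation, of M] pq by auto
    show ?thesis
      using W(2)[OF T] W(2)[OF pq(1,2)] isometric_isoD(1)[OF unitary_op_translation] comm[OF pq(1)]
      by (simp add: pq(3))
  qed
  moreover have "W (wavelet_system \<psi> (n, l)) = wavelet_system \<eta> (n, l)" if "0 \<le> n" for n l
  proof -
    have "wavelet_system \<psi> (n, l) \<in> M" using A[OF that, of 0 l] AM by (auto simp: \<phi>)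
    then show ?thesis using W_M shift[of 0 "(n, l)"] by (simp add: \<phi>)
  qed
  ultimately show ?thesis using core_equivalent_by_unitary[OF W(1) _ \<psi> \<eta>] by blast
qed

theorem theorem3:
  fixes \<psi> :: "'i \<Rightarrow> l2" and I :: "'i set"
  assumes "interpolation_family (\<psi> ` I)"
  shows "\<forall>i\<in>I. \<forall>j\<in>I. core_equivalent (\<psi> i) (\<psi> j)"
proof (intro ballI)
  fix i j assume ij: "i \<in> I" "j \<in> I"
  then have wav: "wavelet (\<psi> i)" "wavelet (\<psi> j)"
    using assms by (auto simp: interpolation_family_def)
  then obtain U where U: "corresponding_unitary (\<psi> i) (\<psi> j) U"
    using corresponding_unitary_exists by metis
  then have "int_power U n \<in> local_commutant (\<psi> i)" for n
    using assms ij unfolding interpolation_family_def by blast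
  with wav U show "core_equivalent (\<psi> i) (\<psi> j)"
    by (rule core_equivalent_if_powers_in_local_commutant)
qed

end
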